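(* Let $r$ be a positive integer and let $\mathbb{M}=(V,\mathcal{C})$ be the rank-$r$ uniform matroid on $n\ge r+2$ elements, i.e. $\mathcal{C}=\{C\subseteq V:|C|=r+1\}$, $|V|=n$. Let $|\mathbb{M}|_C$ be the minimum cardinality of a subfamily $\mathcal{D}\subseteq\mathcal{C}$ with $\Phi_{\mathcal{D}}=\Phi_{\mathcal{C}}$. Then $\binom{n}{r}\big/\left(r+\tfrac12\right)\le|\mathbb{M}|_C\le\binom{n}{r}$.
   Context: Boolean functions on $V$ are viewed as functions of subsets of $V$. The clause $B\to v$ ($v\notin B$) is the function whose true sets are the $T$ with $B\not\subseteq T$ or $B\cup\{v\}\subseteq T$; for $\mathcal{H}\subseteq 2^V$, $\Phi_{\mathcal{H}}=\bigwedge_{H\in\mathcal{H}}\bigwedge_{v\in H}((H\setminus\{v\})\to v)$; equality of CNFs means equality as Boolean functions. *)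

theory Defs
  imports Complex_Main
begin

text \<open>
  A Boolean function on \<open>V\<close> is a predicate \<open>'a set \<Rightarrow> bool\<close> of which only the values on subsets
  of \<open>V\<close> matter; its true sets are the \<open>T \<subseteq> V\<close> satisfying it.
\<close>

definition bool_fun_eq :: "'a set \<Rightarrow> ('a set \<Rightarrow> bool) \<Rightarrow> ('a set \<Rightarrow> bool) \<Rightarrow> bool"
  where "bool_fun_eq V f g \<longleftrightarrow> (\<forall>T. T \<subseteq> V \<longrightarrow> f T = g T)"

definition clause :: "'a set \<Rightarrow> 'a \<Rightarrow> 'a set \<Rightarrow> bool"
  where "clause B v T \<longleftrightarrow> \<not> B \<subseteq> T \<or> B \<union> {v} \<subseteq> T"

definition Phi :: "'a set set \<Rightarrow> 'a set \<Rightarrow> bool"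
  where "Phi \<H> T \<longleftrightarrow> (\<forall>H\<in>\<H>. \<forall>v\<in>H. clause (H - {v}) v T)"

definition uniform_circuits :: "nat \<Rightarrow> 'a set \<Rightarrow> 'a set set"
  where "uniform_circuits r V = {C. C \<subseteq> V \<and> card C = r + 1}"

text \<open>
  The number \<open>|M|\<^sub>C\<close> of the matroid with ground set \<open>V\<close> and family of circuits \<open>\<C>\<close>.
  Finiteness of \<open>\<D>\<close> is automatic for finite \<open>V\<close> and \<open>\<C> \<subseteq> Pow V\<close>; it is
  required because \<open>card\<close> is \<open>0\<close> on infinite sets.
\<close>

definition circuit_number :: "'a set \<Rightarrow> 'a set set \<Rightarrow> nat"
  where "circuit_number V \<C> =
    (LEAST k. \<exists>\<D>. \<D> \<subseteq> \<C> \<and> finite \<D> \<and> bool_fun_eq V (Phi \<D>) (Phi \<C>) \<and> card \<D> = k)"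

end

theory Submission
  imports Defs
begin

text \<open>
  A family \<open>\<D>\<close> of circuits represents the matroid iff every proper subset of \<open>V\<close> with at least
  \<open>r\<close> elements meets some member of \<open>\<D>\<close> in exactly \<open>r\<close> points. The circuits through a fixed
  element have this property, which gives the upper bound. For the lower bound, each \<open>r\<close>-set \<open>T\<close>
  is contained in some number \<open>d(T) \<ge> 1\<close> of members of \<open>\<D>\<close>. Distribute a unit mass from \<open>T\<close>
  equally among them. Each circuit in \<open>\<D>\<close> gets at most \<open>1\<close> from each of its \<open>r + 1\<close> facets (its
  \<open>r\<close>-subsets), and at most \<open>1/2\<close> from one of them: being itself a proper subset of \<open>V\<close> with
  \<open>r + 1\<close> elements, it shares a facet with another member of \<open>\<D>\<close>.
\<close>

text \<open>The clause with head \<open>v\<close> fails at \<open>T\<close> exactly when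
  \<open>v\<close> is the only point of \<open>H\<close> outside \<open>T\<close>. So some clause of
  \<open>H\<close> fails iff \<open>T\<close> misses exactly one of its \<open>r + 1\<close> points,
  which turns the Boolean question into counting.\<close>

lemma Phi_uniform_iff:
  assumes "finite V" "\<D> \<subseteq> uniform_circuits r V"
  shows "Phi \<D> T \<longleftrightarrow> (\<forall>H\<in>\<D>. card (H \<inter> T) \<noteq> r)"
proof -
  have "(\<forall>v\<in>H. clause (H - {v}) v T) \<longleftrightarrow> card (H \<inter> T) \<noteq> r" if "H \<in> \<D>" for H
  proof -
    have H: "card H = r + 1" "finite H"
      using that assms by (auto simp: uniform_circuits_def intro: finite_subset)
    have "(\<exists>v\<in>H. \<not> clause (H - {v}) v T) \<longleftrightarrow> (\<exists>v\<in>H. H \<inter> T = H - {v})"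
      by (intro bex_cong) (auto simp: clause_def)
    also have "\<dots> \<longleftrightarrow> card (H \<inter> T) = r"
    proof
      assume "\<exists>v\<in>H. H \<inter> T = H - {v}"
      then obtain v where "v \<in> H" "H \<inter> T = H - {v}" by blast
      then show "card (H \<inter> T) = r" using H by simp
    next
      assume "card (H \<inter> T) = r"
      then have "card (H - T) = 1"
        using H card_Diff_subset_Int[of H T] by simp
      then obtain v where "H - T = {v}" by (auto simp: card_1_singleton_iff)
      then show "\<exists>v\<in>H. H \<inter> T = H - {v}" by blast
    qed
    finally show ?thesis by blast
  qed
  then show ?thesis unfolding Phi_def by blast
qed

text \<open>The sets \<open>T\<close> in the condition are precisely the false sets of the full CNF:
  \<open>r\<close> points of \<open>T\<close> and one point outside form a circuit that fails at
  \<open>T\<close>, whereas neither \<open>V\<close> nor a set with fewer than \<open>r\<close>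
  elements meets a circuit in exactly \<open>r\<close> points.\<close>

lemma represents_uniform_iff:
  assumes "finite V" "\<D> \<subseteq> uniform_circuits r V"
  shows "bool_fun_eq V (Phi \<D>) (Phi (uniform_circuits r V)) \<longleftrightarrow>
    (\<forall>T. T \<subset> V \<and> r \<le> card T \<longrightarrow> (\<exists>H\<in>\<D>. card (H \<inter> T) = r))"
    (is "?eq \<longleftrightarrow> ?meets")
proof
  assume eq: ?eq
  show ?meets
  proof (intro allI impI)
    fix T assume T: "T \<subset> V \<and> r \<le> card T"
    then obtain S where S: "S \<subseteq> T" "card S = r" "finite S"
      by (metis obtain_subset_with_card_n)
    from T obtain x where x: "x \<in> V - T" by blast
    have "x \<notin> S" "insert x S \<subseteq> V" using S(1) x T by blast+
    then have "insert x S \<in> uniform_circuits r V"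
      using S(2,3) by (simp add: uniform_circuits_def)
    moreover have "insert x S \<inter> T = S" using S x by blast
    ultimately have "\<not> Phi (uniform_circuits r V) T"
      using S(2) Phi_uniform_iff[OF assms(1) order_refl] by fastforce
    then have "\<not> Phi \<D> T"
      using eq T unfolding bool_fun_eq_def by blast
    then show "\<exists>H\<in>\<D>. card (H \<inter> T) = r"
      using Phi_uniform_iff[OF assms] by blast
  qed
next
  assume meets: ?meets
  have "Phi \<D> T = Phi (uniform_circuits r V) T" if T: "T \<subseteq> V" for T
  proof
    assume "Phi (uniform_circuits r V) T"
    then show "Phi \<D> T" using assms(2) unfolding Phi_def by blast
  next
    assume "Phi \<D> T"
    then have no: "\<not> (T \<subset> V \<and> r \<le> card T)"
      using meets Phi_uniform_iff[OF assms] by blast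
    show "Phi (uniform_circuits r V) T"
      unfolding Phi_uniform_iff[OF assms(1) order_refl]
    proof (intro ballI notI)
      fix H assume H: "H \<in> uniform_circuits r V" and r: "card (H \<inter> T) = r"
      have "H \<inter> V = H" using H by (auto simp: uniform_circuits_def)
      moreover have "card H \<noteq> r" using H by (simp add: uniform_circuits_def)
      ultimately have "T \<noteq> V" using r by metis
      moreover have "r \<le> card T"
        using card_mono[of T "H \<inter> T"] r finite_subset[OF T assms(1)] by simp
      ultimately show False using no T by blast
    qed
  qed
  then show ?eq unfolding bool_fun_eq_def by blast
qed

lemma star_represents:
  assumes "r \<ge> 1" "finite V" "x \<in> V"
  shows "bool_fun_eq V (Phi {H \<in> uniform_circuits r V. x \<in> H}) (Phi (uniform_circuits r V))"
proof -
  have "\<exists>H\<in>{H \<in> uniform_circuits r V. x \<in> H}. card (H \<inter> T) = r"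
    if T: "T \<subset> V" "r \<le> card T" for T
  proof -
    have fT: "finite T" using finite_subset[OF psubset_imp_subset[OF T(1)] assms(2)] .
    \<comment> \<open>An \<open>r\<close>-subset \<open>S\<close> of \<open>T\<close> extends by a point outside \<open>T\<close> to a circuit through \<open>x\<close>.\<close>
    obtain S y where S: "S \<subseteq> T" "card S = r" and y: "y \<in> V - T" and x: "x \<in> insert y S"
    proof (cases "x \<in> T")
      case True
      have "r - 1 \<le> card (T - {x})" using True T(2) fT by simp
      then obtain S where S: "S \<subseteq> T - {x}" "card S = r - 1" "finite S"
        by (metis obtain_subset_with_card_n)
      moreover have "x \<notin> S" using S by blast
      \<comment> \<open>Here \<open>r \<ge> 1\<close> matters: subtraction on \<open>nat\<close> is
        truncated, so \<open>r - 1 + 1 = r\<close> fails for \<open>r = 0\<close>.\<close>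
      ultimately have "card (insert x S) = r" using assms(1) by simp
      moreover obtain y where "y \<in> V - T" using T(1) by blast
      ultimately show ?thesis using S(1) True by (intro that[of "insert x S" y]) auto
    next
      \<comment> \<open>Now \<open>x\<close> itself is the added point outside
        \<open>T\<close>.\<close>
      case False
      obtain S where "S \<subseteq> T" "card S = r" using T(2) by (metis obtain_subset_with_card_n)
      then show ?thesis using False assms(3) by (intro that[of S x]) simp_all
    qed
    have "finite S" using S(1) fT by (rule finite_subset)
    have "y \<notin> S" "insert y S \<subseteq> V" using S(1) y T by blast+
    then have "insert y S \<in> uniform_circuits r V"
      using S(2) \<open>finite S\<close> by (simp add: uniform_circuits_def)
    moreover have "insert y S \<inter> T = S" using S y by blast
    ultimately show ?thesis using S(2) x by (intro bexI[of _ "insert y S"]) simp_all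
  qed
  then show ?thesis
    using represents_uniform_iff[OF assms(2), of "{H \<in> uniform_circuits r V. x \<in> H}" r] by simp
qed

text \<open>Deleting \<open>x\<close> is injective on the circuits through \<open>x\<close>. The
  images avoid \<open>x\<close>, so the bound is not sharp in general.\<close>

lemma card_star_le:
  assumes "finite V" "x \<in> V"
  shows "card {H \<in> uniform_circuits r V. x \<in> H} \<le> card V choose r"
proof -
  have "card {H \<in> uniform_circuits r V. x \<in> H} \<le> card {S. S \<subseteq> V \<and> card S = r}"
  proof (rule card_inj_on_le)
    show "inj_on (\<lambda>H. H - {x}) {H \<in> uniform_circuits r V. x \<in> H}"
      by (auto simp: inj_on_def)
    show "(\<lambda>H. H - {x}) ` {H \<in> uniform_circuits r V. x \<in> H} \<subseteq> {S. S \<subseteq> V \<and> card S = r}"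
      by (auto simp: uniform_circuits_def)
  qed (use assms in simp)
  then show ?thesis using assms by (simp add: n_subsets)
qed

lemma represents_lower_bound:
  assumes "finite V" "card V \<ge> r + 2" "\<D> \<subseteq> uniform_circuits r V"
    and "bool_fun_eq V (Phi \<D>) (Phi (uniform_circuits r V))"
  shows "real (card V choose r) \<le> real (card \<D>) * (real r + 1 / 2)"
proof -
  define R where "R = {T. T \<subseteq> V \<and> card T = r}"
  define d where "d T = card {H \<in> \<D>. T \<subseteq> H}" for T
  have finR: "finite R" using assms(1) by (simp add: R_def)
  have circuit: "H \<subseteq> V \<and> finite H \<and> card H = r + 1" if "H \<in> \<D>" for H
    using that assms by (auto simp: uniform_circuits_def intro: finite_subset)
  have finD: "finite \<D>"
    using circuit assms(1) by (intro finite_subset[of \<D> "Pow V"]) auto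
  have meets: "\<exists>H\<in>\<D>. card (H \<inter> T) = r" if "T \<subset> V" "r \<le> card T" for T
    using that assms(4) unfolding represents_uniform_iff[OF assms(1,3)] by blast
  have d_pos: "d T \<ge> 1" if "T \<in> R" for T
  proof -
    have "T \<subseteq> V" "card T = r" using that by (simp_all add: R_def)
    moreover from this have "T \<noteq> V" using assms(2) by auto
    ultimately have T: "T \<subset> V" "r \<le> card T" "card T = r" "finite T"
      using assms(1) finite_subset by blast+
    then obtain H where H: "H \<in> \<D>" "card (H \<inter> T) = r" using meets by blast
    then have "H \<inter> T = T" using T by (metis card_subset_eq inf_le2)
    then have "{H} \<subseteq> {H \<in> \<D>. T \<subseteq> H}" using H by blast
    then have "card {H} \<le> d T" unfolding d_def using finD by (intro card_mono) auto
    then show ?thesis by simp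
  qed
  have facet_sum: "(\<Sum>T | T \<in> R \<and> T \<subseteq> H. 1 / real (d T)) \<le> real r + 1 / 2"
    if H: "H \<in> \<D>" for H
  proof -
    let ?F = "{T. T \<in> R \<and> T \<subseteq> H}"
    have finF: "finite ?F" using finR by simp
    have "?F = {T. T \<subseteq> H \<and> card T = r}" using circuit[OF H] by (auto simp: R_def)
    then have cardF: "card ?F = r + 1"
      using circuit[OF H] by (simp add: n_subsets)
    \<comment> \<open>The bound \<open>card V \<ge> r + 2\<close> makes even a circuit a proper
      subset of \<open>V\<close>, so \<open>meets\<close> applies to \<open>H\<close>
      itself.\<close>
    have "H \<noteq> V" using circuit[OF H] assms(2) by auto
    then have "H \<subset> V" "r \<le> card H" using circuit[OF H] by auto
    then obtain K where K: "K \<in> \<D>" "card (K \<inter> H) = r"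
      using meets by blast
    have ne: "K \<noteq> H"
    proof
      assume "K = H"
      then show False using K(2) circuit[OF H] by simp
    qed
    have "K \<inter> H \<subseteq> V" using circuit[OF H] by blast
    then have KF: "K \<inter> H \<in> ?F" using K(2) by (simp add: R_def)
    have "card {K, H} \<le> d (K \<inter> H)"
      unfolding d_def using finD K H by (intro card_mono) auto
    then have two: "1 / real (d (K \<inter> H)) \<le> 1 / 2"
      using ne by (simp add: field_simps)
    have "(\<Sum>T\<in>?F. 1 / real (d T)) =
        1 / real (d (K \<inter> H)) + (\<Sum>T\<in>?F - {K \<inter> H}. 1 / real (d T))"
      using finF KF by (rule sum.remove)
    also have "\<dots> \<le> 1 / 2 + (\<Sum>T\<in>?F - {K \<inter> H}. 1)"
    proof (intro add_mono sum_mono two)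
      fix T assume "T \<in> ?F - {K \<inter> H}"
      then have "d T \<ge> 1" using d_pos by blast
      then show "1 / real (d T) \<le> 1" by simp
    qed
    also have "\<dots> = real r + 1 / 2"
      using cardF finF KF by (simp add: card_Diff_singleton)
    finally show ?thesis .
  qed
  have "real (card V choose r) = (\<Sum>T\<in>R. 1)"
    using assms(1) by (simp add: R_def n_subsets)
  also have "\<dots> = (\<Sum>T\<in>R. \<Sum>H | H \<in> \<D> \<and> T \<subseteq> H. 1 / real (d T))"
  proof (rule sum.cong)
    fix T assume "T \<in> R"
    then show "1 = (\<Sum>H | H \<in> \<D> \<and> T \<subseteq> H. 1 / real (d T))"
      \<comment> \<open>The \<open>d T\<close> equal shares add up to \<open>1\<close> only because
        \<open>d T\<close> is nonzero.\<close>
      using d_pos[of T] by (simp add: d_def[of T, symmetric])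
  qed simp
  also have "\<dots> = (\<Sum>H\<in>\<D>. \<Sum>T | T \<in> R \<and> T \<subseteq> H. 1 / real (d T))"
    using finR finD by (rule sum.swap_restrict)
  also have "\<dots> \<le> (\<Sum>H\<in>\<D>. real r + 1 / 2)"
    using facet_sum by (rule sum_mono)
  finally show ?thesis by simp
qed

theorem theorem20:
  fixes V :: "'a set" and r n :: nat
  assumes "r \<ge> 1" and "finite V" and "card V = n" and "n \<ge> r + 2"
  shows "real (n choose r) / (real r + 1 / 2) \<le> real (circuit_number V (uniform_circuits r V))
    \<and> circuit_number V (uniform_circuits r V) \<le> n choose r"
proof -
  let ?C = "uniform_circuits r V"
  let ?P = "\<lambda>k. \<exists>\<D>. \<D> \<subseteq> ?C \<and> finite \<D> \<and> bool_fun_eq V (Phi \<D>) (Phi ?C) \<and> card \<D> = k"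
  have "V \<noteq> {}" using assms(3,4) by auto
  then obtain x where x: "x \<in> V" by blast
  let ?S = "{H \<in> ?C. x \<in> H}"
  have "finite ?S" using assms(2) by (simp add: uniform_circuits_def)
  \<comment> \<open>The star serves twice: its size bounds the minimum from above, and its existence
    ensures that the minimum is attained by some \<open>\<D>\<close>.\<close>
  then have S: "?P (card ?S)"
    using star_represents[OF assms(1,2) x] by (intro exI[of _ ?S] conjI) simp_all
  have "circuit_number V ?C \<le> card ?S"
    unfolding circuit_number_def using S by (rule Least_le)
  then have upper: "circuit_number V ?C \<le> n choose r"
    using card_star_le[OF assms(2) x, of r] assms(3) by simp
  have "?P (circuit_number V ?C)"
    unfolding circuit_number_def using S by (rule LeastI)
  then obtain \<D> where D: "\<D> \<subseteq> ?C" "bool_fun_eq V (Phi \<D>) (Phi ?C)" "card \<D> = circuit_number V ?C"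
    by (elim exE conjE)
  then have "real (n choose r) \<le> real (circuit_number V ?C) * (real r + 1 / 2)"
    using represents_lower_bound[OF assms(2) _ D(1,2)] assms(3,4) by simp
  then show ?thesis using upper by (simp add: pos_divide_le_eq)
qed

end
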